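(* Let $\epsilon > 0$ and $b > 0$ be given. Let $w^i = (w^i_k)_{k \geq 1}$ be a sequence of mutually independent random variables with $w^i_k \sim \mathrm{Lap}(b/\epsilon)$ for every $k$. Then the mechanism $$M_i(d^i) = d^i + w^i,$$ which maps customer $i$'s demand trajectory $d^i = (d^i_k)_{k\ge 1} \in \tilde{\ell}_1$ to the random trajectory $(d^i_k + w^i_k)_{k \geq 1}$, is $\epsilon$-differentially private with respect to the adjacency relation $\mathrm{Adj}_b$. That is, for all $u_1, u_2 \in \tilde{\ell}_1$ with $\mathrm{Adj}_b(u_1,u_2) = 1$ and all $S \in \Sigma$, $$\mathbb{P}[M_i(u_1) \in S] \leq e^{\epsilon}\, \mathbb{P}[M_i(u_2) \in S].$$
   Context: For $c>0$, $\mathrm{Lap}(c)$ denotes the Laplace distribution on $\mathbb{R}$ with mean $0$ and scale parameter $c$, i.e. with density $x \mapsto \frac{1}{2c}\exp(-|x|/c)$. Signals are real sequences $u = (u_k)_{k \geq 1}$. For $T \in \mathbb{N}$ the truncation $P_T[u]$ is the sequence equal to $u_k$ for $k \leq T$ and $0$ for $k > T$. The space $\tilde{\ell}_1$ is the set of signals $u$ such that $P_T[u] \in \ell_1$ for all $T \in \mathbb{N}$ (so it is the set of all real sequences). $\Sigma$ is the $\sigma$-algebra on $\tilde{\ell}_1$ generated by the coordinate maps. Adjacency: for $b>0$ and $u_1,u_2 \in \tilde{\ell}_1$, $\mathrm{Adj}_b(u_1,u_2) = 1$ if $\|u_1 - u_2\|_{\ell_1} \leq b$ (in particular $u_1-u_2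 \in \ell_1$), and $\mathrm{Adj}_b(u_1,u_2) = 0$ otherwise. *)

theory Defs
  imports "HOL-Probability.Probability"
begin

(* Signals are indexed by the positive integers. They are represented as functions on nat
   that are extensional on {1..}, so that equality of functions is equality of signals;
   the value at the index 0 carries no information. *)
type_synonym signal = "nat \<Rightarrow> real"

definition signals :: "signal set" where
  "signals = extensional {1..}"

definition ell1 :: "signal set" where
  "ell1 = {u \<in> signals. (\<lambda>k. \<bar>u k\<bar>) summable_on {1..}}"

(* Meaningful on ell1 only: infsum is 0 where the sum does not converge. *)
definition norm_ell1 :: "signal \<Rightarrow> real" where
  "norm_ell1 u = (\<Sum>\<^sub>\<infinity>k\<in>{1..}. \<bar>u k\<bar>)"

definition truncation :: "nat \<Rightarrow> signal \<Rightarrow> signal" where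
  "truncation T u = (\<lambda>k\<in>{1..}. if k \<le> T then u k else 0)"

definition ell1_ext :: "signal set" where
  "ell1_ext = {u \<in> signals. \<forall>T. truncation T u \<in> ell1}"

definition signal_space :: "signal measure" where
  "signal_space =
     sigma ell1_ext {(\<lambda>u. u k) -` B \<inter> ell1_ext | k B. 1 \<le> k \<and> B \<in> sets borel}"

definition signal_diff :: "signal \<Rightarrow> signal \<Rightarrow> signal" where
  "signal_diff u v = (\<lambda>k\<in>{1..}. u k - v k)"

definition Adj :: "real \<Rightarrow> signal \<Rightarrow> signal \<Rightarrow> bool" where
  "Adj b u v \<longleftrightarrow> signal_diff u v \<in> ell1 \<and> norm_ell1 (signal_diff u v) \<le> b"

definition laplace_density :: "real \<Rightarrow> real \<Rightarrow> real" where
  "laplace_density c x = 1 / (2 * c) * exp (- \<bar>x\<bar> / c)"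

(* A mechanism assigns a random element of R to each element of D. The measurability
   conjunct makes every event M u \<in> S measurable, so that prob is its genuine
   probability and not the default value 0 of a non-measurable set. *)
definition differentially_private ::
    "'w measure \<Rightarrow> 'd set \<Rightarrow> 'r measure \<Rightarrow> ('d \<Rightarrow> 'd \<Rightarrow> bool) \<Rightarrow> real \<Rightarrow> ('d \<Rightarrow> 'w \<Rightarrow> 'r) \<Rightarrow> bool"
where
  "differentially_private P D R adj \<epsilon> M \<longleftrightarrow>
     (\<forall>u\<in>D. M u \<in> measurable P R) \<and>
     (\<forall>u\<^sub>1\<in>D. \<forall>u\<^sub>2\<in>D. adj u\<^sub>1 u\<^sub>2 \<longrightarrow>
        (\<forall>S\<in>sets R. \<P>(\<omega> in P. M u\<^sub>1 \<omega> \<in> S) \<le> exp \<epsilon> * \<P>(\<omega> in P. M u\<^sub>2 \<omega> \<in> S)))"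

definition additive_mechanism :: "(nat \<Rightarrow> 'w \<Rightarrow> real) \<Rightarrow> signal \<Rightarrow> 'w \<Rightarrow> signal" where
  "additive_mechanism w d \<omega> = (\<lambda>k\<in>{1..}. d k + w k \<omega>)"

end

theory Submission
  imports Defs
begin

text \<open>
  Let \<open>u\<close> and \<open>v\<close> be adjacent, \<open>t = u - v\<close> and \<open>c = b / \<epsilon>\<close>. Adding \<open>u\<close> to the noise gives the
  same random signal as adding \<open>v\<close> to the noise shifted by \<open>t\<close>, and shifting a Laplace variable by
  \<open>t k\<close> multiplies its density at \<open>x\<close> by \<open>exp ((\<bar>x\<bar> - \<bar>x - t k\<bar>) / c)\<close>. The exponent is at most
  \<open>\<bar>t k\<bar> / c\<close> in absolute value, whatever \<open>x\<close> is. As \<open>t\<close> is absolutely summable, the exponents of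
  all coordinates have a convergent sum, so that the infinite product of the density ratios exists
  pointwise. This product \<open>Z\<close> (\<open>noise_density\<close>) satisfies \<open>Z \<le> exp (norm_ell1 t / c) \<le> exp \<epsilon>\<close>.

  The heart of the proof is that \<open>Z\<close> really is the Radon-Nikodym derivative that the finite products
  suggest: the law of \<open>u + w\<close> under \<open>P\<close> is the law of \<open>v + w\<close> under \<open>Z\<close> times \<open>P\<close>
  (\<open>distr_additive_mechanism_shift\<close>). Both are finite measures on a product space, so it suffices to
  compare them on boxes that constrain finitely many coordinates. There, independence reduces the
  claim for each finite partial product to the shift of a single Laplace variable, and the uniform
  bound lets dominated convergence pass to \<open>Z\<close> (\<open>nn_integral_noise_density_prod\<close>).

  Given this identity, an arbitrary measurable set \<open>S\<close> needs no approximation by cylinders: the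
  probability of \<open>u + w \<in> S\<close> is the integral of \<open>Z\<close> over the event \<open>v + w \<in> S\<close>, and \<open>Z\<close> is bounded
  by \<open>exp \<epsilon>\<close> at every point.
\<close>

section \<open>Signals as an infinite product space\<close>

lemma ell1_ext_eq_signals: "ell1_ext = signals"
proof -
  have "truncation T u \<in> ell1" for T u
  proof -
    have "(\<lambda>k. \<bar>truncation T u k\<bar>) summable_on {1..T}"
      by simp
    also have "?this \<longleftrightarrow> (\<lambda>k. \<bar>truncation T u k\<bar>) summable_on {1..}"
      by (rule summable_on_cong_neutral) (auto simp: truncation_def)
    finally show ?thesis
      by (auto simp: ell1_def signals_def truncation_def)
  qed
  then show ?thesis
    by (auto simp: ell1_ext_def)
qed

text \<open>
  Identifying the \<open>\<sigma>\<close>-algebra with the product one makes measurability coordinatewise and makes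
  agreement on finite-dimensional boxes enough for the equality of two laws.
\<close>

lemma sets_signal_space: "sets signal_space = sets (\<Pi>\<^sub>M k\<in>{1..}. borel :: real measure)"
proof -
  have "{(\<lambda>u. u k) -` B \<inter> ell1_ext | k B. 1 \<le> k \<and> B \<in> sets (borel :: real measure)} =
        {{f \<in> \<Pi>\<^sub>E k\<in>{1..}. space (borel :: real measure). f i \<in> A} | i A. i \<in> {1..} \<and> A \<in> sets borel}"
    by (auto simp: ell1_ext_eq_signals signals_def PiE_def)
  moreover have "ell1_ext = (\<Pi>\<^sub>E k\<in>{1..}. space (borel :: real measure))"
    by (simp add: ell1_ext_eq_signals signals_def PiE_def)
  ultimately show ?thesis
    unfolding signal_space_def sets_PiM_single
    by (subst sets_measure_of) auto
qed

lemma measurable_additive_mechanism: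
  assumes "\<And>k. k \<ge> 1 \<Longrightarrow> w k \<in> borel_measurable P"
  shows "additive_mechanism w d \<in> measurable P (\<Pi>\<^sub>M k\<in>{1..}. borel)"
  unfolding additive_mechanism_def[abs_def]
  by (rule measurable_restrict) (use assms in auto)

section \<open>Shifting a Laplace variable\<close>

text \<open>
  The logarithm of the density of \<open>X + t\<close> over that of \<open>X\<close>, for \<open>X\<close> Laplace distributed with
  scale \<open>c\<close>.
\<close>

definition laplace_log_ratio :: "real \<Rightarrow> real \<Rightarrow> real \<Rightarrow> real" where
  "laplace_log_ratio c t x = (\<bar>x\<bar> - \<bar>x - t\<bar>) / c"

lemma laplace_log_ratio_measurable [measurable]:
  "laplace_log_ratio c t \<in> borel_measurable borel"
  unfolding laplace_log_ratio_def[abs_def] by measurable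

lemma laplace_density_measurable [measurable]: "laplace_density c \<in> borel_measurable borel"
  unfolding laplace_density_def[abs_def] by measurable

lemma abs_laplace_log_ratio_le: "c > 0 \<Longrightarrow> \<bar>laplace_log_ratio c t x\<bar> \<le> \<bar>t\<bar> / c"
  by (auto simp: laplace_log_ratio_def abs_divide intro!: divide_right_mono)

lemma laplace_density_shift:
  "laplace_density c x * exp (laplace_log_ratio c t x) = laplace_density c (x - t)"
  by (simp add: laplace_density_def laplace_log_ratio_def diff_divide_distrib flip: exp_add)

text \<open>
  The one-dimensional change of measure: weighting with the density ratio has the same effect as
  shifting the variable, by translation invariance of Lebesgue measure.
\<close>

lemma laplace_nn_integral_shift:
  fixes g :: "real \<Rightarrow> ennreal"
  assumes "c > 0" and X: "distributed P lborel X (laplace_density c)"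
    and [measurable]: "g \<in> borel_measurable borel"
  shows "(\<integral>\<^sup>+\<omega>. ennreal (exp (laplace_log_ratio c t (X \<omega>))) * g (X \<omega>) \<partial>P) =
         (\<integral>\<^sup>+\<omega>. g (X \<omega> + t) \<partial>P)"
proof -
  have nonneg: "0 \<le> laplace_density c x" for x
    using \<open>c > 0\<close> by (simp add: laplace_density_def)
  have "(\<integral>\<^sup>+\<omega>. ennreal (exp (laplace_log_ratio c t (X \<omega>))) * g (X \<omega>) \<partial>P) =
      (\<integral>\<^sup>+x. laplace_density c x * (ennreal (exp (laplace_log_ratio c t x)) * g x) \<partial>lborel)"
    by (rule distributed_nn_integral[OF X, symmetric]) measurable
  also have "\<dots> = (\<integral>\<^sup>+x. laplace_density c (x - t) * g x \<partial>lborel)"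
    by (intro nn_integral_cong)
       (simp add: nonneg ennreal_mult' flip: laplace_density_shift[of c _ t] mult.assoc)
  also have "\<dots> = (\<integral>\<^sup>+x. laplace_density c x * g (x + t) \<partial>lborel)"
    by (subst nn_integral_real_affine[where c = 1 and t = t]) (simp_all add: add.commute)
  also have "\<dots> = (\<integral>\<^sup>+\<omega>. g (X \<omega> + t) \<partial>P)"
    by (rule distributed_nn_integral[OF X]) measurable
  finally show ?thesis .
qed

section \<open>Shifting an infinite sequence of Laplace variables\<close>

text \<open>
  The product of the density ratios of all coordinates, written as the exponential of a series: for
  \<open>t \<in> ell1\<close> the series converges absolutely, while a quotient of densities is not available, as
  there is no Lebesgue measure on sequences. The argument \<open>Suc k\<close> accounts for signals being indexed from 1.
\<close>

definition noise_density :: "real \<Rightarrow> signal \<Rightarrow> (nat \<Rightarrow> 'w \<Rightarrow> real) \<Rightarrow> 'w \<Rightarrow> real" where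
  "noise_density c t w \<omega> = exp (\<Sum>k. laplace_log_ratio c (t (Suc k)) (w (Suc k) \<omega>))"

lemma noise_density_measurable:
  assumes "\<And>k. k \<ge> 1 \<Longrightarrow> w k \<in> borel_measurable P"
  shows "noise_density c t w \<in> borel_measurable P"
proof -
  have [measurable]: "w (Suc k) \<in> borel_measurable P" for k
    using assms by simp
  show ?thesis
    unfolding noise_density_def[abs_def] by measurable
qed

text \<open>
  The bound does not depend on \<open>n\<close> or on the values of the noise; it serves both as the majorant
  for dominated convergence and, in the limit, as the privacy guarantee.
\<close>

lemma partial_log_ratio_le_norm_ell1:
  assumes "c > 0" "t \<in> ell1"
  shows "(\<Sum>k\<in>{1..n}. laplace_log_ratio c (t k) (x k)) \<le> norm_ell1 t / c"
proof -
  have "(\<Sum>k\<in>{1..n}. laplace_log_ratio c (t k) (x k)) \<le> (\<Sum>k\<in>{1..n}. \<bar>t k\<bar> / c)"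
    using abs_laplace_log_ratio_le[OF \<open>c > 0\<close>] by (intro sum_mono) (smt (verit))
  also have "\<dots> = (\<Sum>k\<in>{1..n}. \<bar>t k\<bar>) / c"
    by (simp add: sum_divide_distrib)
  also have "(\<Sum>k\<in>{1..n}. \<bar>t k\<bar>) \<le> norm_ell1 t"
    unfolding norm_ell1_def by (rule finite_sum_le_infsum) (use assms in \<open>auto simp: ell1_def\<close>)
  finally show ?thesis
    using \<open>c > 0\<close> by (simp add: divide_right_mono)
qed

lemma partial_densities_tendsto:
  assumes "c > 0" "t \<in> ell1"
  shows "(\<lambda>n. exp (\<Sum>k\<in>{1..n}. laplace_log_ratio c (t k) (w k \<omega>))) \<longlonglongrightarrow> noise_density c t w \<omega>"
proof -
  have Suc_range: "range Suc = {1..}"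
    by (auto simp: image_iff intro: Suc_le_D)
  have "(\<lambda>k. \<bar>t k\<bar>) summable_on Suc ` UNIV"
    using \<open>t \<in> ell1\<close> by (simp add: ell1_def Suc_range)
  then have "summable (\<lambda>k. \<bar>t (Suc k)\<bar>)"
    by (subst (asm) summable_on_reindex) (simp_all add: o_def summable_on_UNIV_nonneg_real_iff)
  then have "summable (\<lambda>k. \<bar>t (Suc k)\<bar> / c)"
    by (rule summable_divide)
  then have "summable (\<lambda>k. laplace_log_ratio c (t (Suc k)) (w (Suc k) \<omega>))"
    by (rule summable_comparison_test'[where N = 0])
       (simp add: abs_laplace_log_ratio_le[OF \<open>c > 0\<close>])
  then have "(\<lambda>n. \<Sum>k<n. laplace_log_ratio c (t (Suc k)) (w (Suc k) \<omega>))
      \<longlonglongrightarrow> (\<Sum>k. laplace_log_ratio c (t (Suc k)) (w (Suc k) \<omega>))"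
    by (rule summable_LIMSEQ)
  then show ?thesis
    unfolding noise_density_def One_nat_def sum.atLeast1_atMost_eq by (intro tendsto_intros)
qed

lemma noise_density_le:
  assumes "c > 0" "t \<in> ell1"
  shows "noise_density c t w \<omega> \<le> exp (norm_ell1 t / c)"
  by (rule LIMSEQ_le_const2[OF partial_densities_tendsto[OF assms]])
     (use partial_log_ratio_le_norm_ell1[OF assms] in auto)

text \<open>
  Weighting with the infinite product shifts every coordinate at once, as far as functions of finitely
  many coordinates can tell. If \<open>{1..n}\<close> contains \<open>J\<close>, the weight truncated at \<open>n\<close> already gives the
  right-hand side: by independence the integral splits into one-dimensional ones, and each coordinate
  outside \<open>J\<close> contributes the total mass 1 of a shifted Laplace law. The integrals of the truncated
  weights are therefore eventually constant, while by dominated convergence they tend to the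
  left-hand side.
\<close>

lemma (in prob_space) nn_integral_noise_density_prod:
  fixes g :: "nat \<Rightarrow> real \<Rightarrow> ennreal"
  assumes "c > 0" "t \<in> ell1"
    and indep: "indep_vars (\<lambda>_. borel) w {1..}"
    and lap: "\<And>k. k \<ge> 1 \<Longrightarrow> distributed M lborel (w k) (laplace_density c)"
    and J: "finite J" "J \<subseteq> {1..}"
    and g [measurable]: "\<And>k. g k \<in> borel_measurable borel" and g_le: "\<And>k x. g k x \<le> 1"
  shows "(\<integral>\<^sup>+\<omega>. noise_density c t w \<omega> * (\<Prod>k\<in>J. g k (w k \<omega>)) \<partial>M) =
         (\<integral>\<^sup>+\<omega>. (\<Prod>k\<in>J. g k (w k \<omega> + t k)) \<partial>M)"
proof -
  \<comment> \<open>Padding with the constant 1 lets the weights and the factors share the index set \<open>{1..n}\<close>.\<close>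
  define h where "h k = (if k \<in> J then g k else (\<lambda>_. 1))" for k
  have [measurable]: "h k \<in> borel_measurable borel" for k
    by (simp add: h_def)
  have w [measurable]: "w k \<in> borel_measurable M" if "k \<ge> 1" for k
    using distributed_measurable[OF lap[OF that]] by simp
  have noise [measurable]: "noise_density c t w \<in> borel_measurable M"
    by (rule noise_density_measurable) (rule w)
  have prod_meas: "(\<lambda>\<omega>. \<Prod>k\<in>J. g k (w k \<omega>)) \<in> borel_measurable M"
    using J by (intro borel_measurable_prod_ennreal measurable_compose[OF w g]) auto
  have sum_meas: "(\<lambda>\<omega>. \<Sum>k\<in>{1..n}. laplace_log_ratio c (t k) (w k \<omega>)) \<in> borel_measurable M" for n
    by (intro borel_measurable_sum measurable_compose[OF w laplace_log_ratio_measurable]) auto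
  have prod_le: "(\<Prod>k\<in>J. g k (w k \<omega>)) \<le> 1" for \<omega>
    by (intro prod_le_1) (simp add: g_le)
  have prod_h: "(\<Prod>k\<in>{1..n}. h k (x k)) = (\<Prod>k\<in>J. g k (x k))" if "J \<subseteq> {1..n}" for n x
    using that by (intro prod.mono_neutral_cong_right) (auto simp: h_def)
  define F where "F n \<omega> = ennreal (exp (\<Sum>k\<in>{1..n}. laplace_log_ratio c (t k) (w k \<omega>))) *
    (\<Prod>k\<in>J. g k (w k \<omega>))" for n \<omega>
  have F_integral: "(\<integral>\<^sup>+\<omega>. F n \<omega> \<partial>M) = (\<integral>\<^sup>+\<omega>. (\<Prod>k\<in>J. g k (w k \<omega> + t k)) \<partial>M)"
    if "J \<subseteq> {1..n}" for n
  proof -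
    have indep_n: "indep_vars (\<lambda>_. borel) w {1..n}"
      by (rule indep_vars_subset[OF indep]) auto
    have "(\<integral>\<^sup>+\<omega>. F n \<omega> \<partial>M) =
        (\<integral>\<^sup>+\<omega>. (\<Prod>k\<in>{1..n}. ennreal (exp (laplace_log_ratio c (t k) (w k \<omega>))) * h k (w k \<omega>)) \<partial>M)"
      by (simp add: F_def exp_sum prod.distrib prod_ennreal prod_h[OF that, unfolded One_nat_def])
    also have "\<dots> =
        (\<Prod>k\<in>{1..n}. \<integral>\<^sup>+\<omega>. ennreal (exp (laplace_log_ratio c (t k) (w k \<omega>))) * h k (w k \<omega>) \<partial>M)"
      by (intro indep_vars_nn_integral indep_vars_compose2[OF indep_n]) auto
    also have "\<dots> = (\<Prod>k\<in>{1..n}. \<integral>\<^sup>+\<omega>. h k (w k \<omega> + t k) \<partial>M)"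
      by (intro prod.cong refl laplace_nn_integral_shift[OF \<open>c > 0\<close> lap]) auto
    also have "\<dots> = (\<integral>\<^sup>+\<omega>. (\<Prod>k\<in>{1..n}. h k (w k \<omega> + t k)) \<partial>M)"
      by (intro indep_vars_nn_integral[symmetric]
          indep_vars_compose2[OF indep_n, where Y = "\<lambda>k x. h k (x + t k)"]) auto
    finally show ?thesis
      by (simp only: prod_h[OF that])
  qed
  have "(\<lambda>n. \<integral>\<^sup>+\<omega>. F n \<omega> \<partial>M)
      \<longlonglongrightarrow> (\<integral>\<^sup>+\<omega>. noise_density c t w \<omega> * (\<Prod>k\<in>J. g k (w k \<omega>)) \<partial>M)"
  proof (rule nn_integral_dominated_convergence[where w = "\<lambda>_. exp (norm_ell1 t / c)"])
    show "AE \<omega> in M. F n \<omega> \<le> exp (norm_ell1 t / c)" for n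
    proof (rule AE_I2)
      fix \<omega>
      have "F n \<omega> \<le> ennreal (exp (norm_ell1 t / c)) * 1"
        unfolding F_def
        using partial_log_ratio_le_norm_ell1[OF assms(1,2)]
        by (intro mult_mono prod_le) (auto intro!: ennreal_leI)
      then show "F n \<omega> \<le> exp (norm_ell1 t / c)"
        by simp
    qed
    show "AE \<omega> in M. (\<lambda>n. F n \<omega>) \<longlonglongrightarrow> noise_density c t w \<omega> * (\<Prod>k\<in>J. g k (w k \<omega>))"
      unfolding F_def
      by (intro AE_I2 tendsto_mult_ennreal tendsto_ennrealI partial_densities_tendsto assms tendsto_const)
         (use prod_le in \<open>auto simp: noise_density_def\<close>)
  qed (use sum_meas prod_meas noise in \<open>auto simp: F_def[abs_def] emeasure_space_1\<close>)
  moreover have "(\<lambda>n. \<integral>\<^sup>+\<omega>. F n \<omega> \<partial>M) \<longlonglongrightarrow> (\<integral>\<^sup>+\<omega>. (\<Prod>k\<in>J. g k (w k \<omega> + t k)) \<partial>M)"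
  proof (rule tendsto_eventually)
    obtain n\<^sub>0 where "J \<subseteq> {..n\<^sub>0}"
      using \<open>finite J\<close> finite_nat_iff_bounded_le by auto
    then have "J \<subseteq> {1..n}" if "n \<ge> n\<^sub>0" for n
      using that J by fastforce
    then show "\<forall>\<^sub>F n in sequentially. (\<integral>\<^sup>+\<omega>. F n \<omega> \<partial>M) = (\<integral>\<^sup>+\<omega>. (\<Prod>k\<in>J. g k (w k \<omega> + t k)) \<partial>M)"
      unfolding eventually_sequentially using F_integral by blast
  qed
  ultimately show ?thesis
    by (rule LIMSEQ_unique)
qed

text \<open>
  The indicator of a finite-dimensional box is a product of functions of single coordinates, so the
  preceding lemma gives the equality of the two laws on all boxes, and hence everywhere.
\<close>

lemma (in prob_space) distr_additive_mechanism_shift: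
  assumes "c > 0" "signal_diff u v \<in> ell1"
    and indep: "indep_vars (\<lambda>_. borel) w {1..}"
    and lap: "\<And>k. k \<ge> 1 \<Longrightarrow> distributed M lborel (w k) (laplace_density c)"
  shows "distr M (\<Pi>\<^sub>M k\<in>{1..}. borel) (additive_mechanism w u) =
         distr (density M (noise_density c (signal_diff u v) w)) (\<Pi>\<^sub>M k\<in>{1..}. borel)
           (additive_mechanism w v)"
proof (rule measure_eqI_PiM_infinite)
  let ?S = "\<Pi>\<^sub>M k\<in>{1..}. borel :: real measure" and ?Z = "noise_density c (signal_diff u v) w"
  have w: "w k \<in> borel_measurable M" if "k \<ge> 1" for k
    using distributed_measurable[OF lap[OF that]] by simp
  have mech: "additive_mechanism w d \<in> measurable M ?S" for d
    by (rule measurable_additive_mechanism) (rule w)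
  have [measurable]: "?Z \<in> borel_measurable M"
    by (rule noise_density_measurable) (rule w)
  show "finite_measure (distr M ?S (additive_mechanism w u))"
    by (intro finite_measure_distr mech)
  fix A :: "nat \<Rightarrow> real set" and J
  assume J: "finite J" "J \<subseteq> {1..}" and A: "\<And>k. k \<in> J \<Longrightarrow> A k \<in> sets borel"
  let ?B = "prod_emb {1..} (\<lambda>_. borel) J (Pi\<^sub>E J A)"
  have B: "?B \<in> sets ?S"
    using J A by (intro sets_PiM_I) auto
  have event: "indicator ?B (additive_mechanism w d \<omega>) =
      (\<Prod>k\<in>J. indicator (A k) (w k \<omega> + d k) :: ennreal)" for d \<omega>
  proof -
    have "additive_mechanism w d \<omega> \<in> ?B \<longleftrightarrow> (\<forall>k\<in>J. w k \<omega> + d k \<in> A k)"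
      using J by (auto simp: prod_emb_def additive_mechanism_def PiE_iff restrict_def add.commute
          extensional_def subset_iff)
    then show ?thesis
      using \<open>finite J\<close> by (auto simp: indicator_def prod_zero_iff)
  qed
  \<comment> \<open>\<open>A k\<close> is known to be measurable only for \<open>k \<in> J\<close>; the empty set makes \<open>g k\<close> measurable for all \<open>k\<close>.\<close>
  define g where "g k x = (indicator (if k \<in> J then A k else {}) (x + v k) :: ennreal)" for k x
  have g_meas: "g k \<in> borel_measurable borel" for k
    using A by (cases "k \<in> J") (auto simp: g_def[abs_def])
  have "emeasure (distr (density M ?Z) ?S (additive_mechanism w v)) ?B =
      (\<integral>\<^sup>+\<omega>. indicator ?B (additive_mechanism w v \<omega>) \<partial>density M ?Z)"
    using B mech by (simp add: nn_integral_distr flip: nn_integral_indicator)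
  also have "\<dots> = (\<integral>\<^sup>+\<omega>. ennreal (?Z \<omega>) * indicator ?B (additive_mechanism w v \<omega>) \<partial>M)"
    using measurable_compose[OF mech borel_measurable_indicator[OF B]]
    by (intro nn_integral_density) auto
  also have "\<dots> = (\<integral>\<^sup>+\<omega>. ?Z \<omega> * (\<Prod>k\<in>J. g k (w k \<omega>)) \<partial>M)"
    unfolding event
    by (intro nn_integral_cong arg_cong2[where f = times] prod.cong refl) (simp add: g_def)
  also have "\<dots> = (\<integral>\<^sup>+\<omega>. (\<Prod>k\<in>J. g k (w k \<omega> + signal_diff u v k)) \<partial>M)"
    by (rule nn_integral_noise_density_prod[OF assms J g_meas]) (auto simp: g_def indicator_def)
  also have "\<dots> = (\<integral>\<^sup>+\<omega>. indicator ?B (additive_mechanism w u \<omega>) \<partial>M)"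
    unfolding event using J
    by (intro nn_integral_cong prod.cong refl) (auto simp: g_def signal_diff_def)
  also have "\<dots> = emeasure (distr M ?S (additive_mechanism w u)) ?B"
    using B mech by (simp add: nn_integral_distr flip: nn_integral_indicator)
  finally show "emeasure (distr M ?S (additive_mechanism w u)) ?B =
      emeasure (distr (density M ?Z) ?S (additive_mechanism w v)) ?B" ..
qed simp_all

theorem theorem1:
  fixes \<epsilon> b :: real
    and P :: "'w measure"
    and w :: "nat \<Rightarrow> 'w \<Rightarrow> real"
  assumes "\<epsilon> > 0"
    and "b > 0"
    and "prob_space P"
    and "prob_space.indep_vars P (\<lambda>_. borel) w {1..}"
    and "\<And>k. k \<ge> 1 \<Longrightarrow> distributed P lborel (w k) (laplace_density (b / \<epsilon>))"
  shows "differentially_private P ell1_ext signal_space (Adj b) \<epsilon> (additive_mechanism w)"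
proof -
  interpret prob_space P by fact
  let ?S = "\<Pi>\<^sub>M k\<in>{1..}. borel :: real measure" and ?c = "b / \<epsilon>"
  have c: "?c > 0"
    using assms by simp
  have w: "w k \<in> borel_measurable P" if "k \<ge> 1" for k
    using distributed_measurable[OF assms(5)[OF that]] by simp
  have mech: "additive_mechanism w d \<in> measurable P ?S" for d
    by (rule measurable_additive_mechanism) (rule w)
  have "\<P>(\<omega> in P. additive_mechanism w u \<omega> \<in> S) \<le> exp \<epsilon> * \<P>(\<omega> in P. additive_mechanism w v \<omega> \<in> S)"
    if adj: "Adj b u v" and S: "S \<in> sets ?S" for u v S
  proof -
    let ?Z = "noise_density ?c (signal_diff u v) w"
    let ?E = "\<lambda>d. {\<omega> \<in> space P. additive_mechanism w d \<omega> \<in> S}"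
    have E: "additive_mechanism w d -` S \<inter> space P = ?E d" for d
      by auto
    have E_sets: "?E d \<in> sets P" for d
      using measurable_sets[OF mech S] by (simp add: E)
    have diff: "signal_diff u v \<in> ell1" "norm_ell1 (signal_diff u v) \<le> b"
      using adj by (auto simp: Adj_def)
    have Z_meas: "?Z \<in> borel_measurable P"
      by (rule noise_density_measurable) (rule w)
    have "norm_ell1 (signal_diff u v) / ?c \<le> b / ?c"
      using c diff(2) by (intro divide_right_mono) auto
    also have "b / ?c = \<epsilon>"
      using assms by simp
    finally have Z_le: "?Z \<omega> \<le> exp \<epsilon>" for \<omega>
      using noise_density_le[OF c diff(1), of w \<omega>] by (meson exp_le_cancel_iff order_trans)
    have "emeasure P (?E u) = emeasure (distr P ?S (additive_mechanism w u)) S"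
      using mech S by (simp add: emeasure_distr E)
    also have "\<dots> = emeasure (distr (density P ?Z) ?S (additive_mechanism w v)) S"
      by (simp only: distr_additive_mechanism_shift[OF c diff(1) assms(4,5)])
    also have "\<dots> = emeasure (density P ?Z) (?E v)"
      using mech S by (simp add: emeasure_distr E)
    also have "\<dots> = (\<integral>\<^sup>+\<omega>. ennreal (?Z \<omega>) * indicator (?E v) \<omega> \<partial>P)"
      using Z_meas E_sets by (intro emeasure_density) auto
    also have "\<dots> \<le> (\<integral>\<^sup>+\<omega>. ennreal (exp \<epsilon>) * indicator (?E v) \<omega> \<partial>P)"
      using Z_le by (intro nn_integral_mono mult_right_mono ennreal_leI) auto
    also have "\<dots> = ennreal (exp \<epsilon>) * emeasure P (?E v)"
      using E_sets by (simp add: nn_integral_cmult_indicator)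
    finally show ?thesis
      by (simp add: emeasure_eq_measure flip: ennreal_mult)
  qed
  moreover have "additive_mechanism w d \<in> measurable P signal_space" for d
    using mech measurable_cong_sets[OF refl sets_signal_space] by blast
  ultimately show ?thesis
    by (simp add: differentially_private_def sets_signal_space)
qed

end
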